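(* Let the channel gains $h_1,\dots,h_M\in\mathbb{C}\setminus\{0\}$ of $M\ge 2$ transmission nodes (TNs) be labelled so that $|h_1|\ge|h_2|\ge\cdots\ge|h_M|$. For $1\le\bar M\le M$ let $E_{\rm ETPA}^{\bar M}$ be the total power consumption when TNs $1,\dots,\bar M$ are active with their optimal transmission powers for required data rate $R_{\rm dl}$ and the other TNs are idle (see the context for the explicit expression). Then for every $\bar M\in\{1,\dots,M-1\}$, it is more energy-efficient to activate the additional TN $\bar M+1$, i.e. $E_{\rm ETPA}^{\bar M+1}<E_{\rm ETPA}^{\bar M}$, if and only if $$\frac{\Gamma(\bar M+1)}{\sum_{m=1}^{\bar M}\Gamma(m)\cdot\sum_{m=1}^{\bar M+1}\Gamma(m)}>\frac{\theta_{\bar M+1}(1+a)}{2^{R_{\rm dl}/W}-1},$$ where $$\Gamma(m)=\frac{\eta_{\max,m}|h_m|^2}{I_{\rm out}+P_N},\qquad \theta_{\bar M+1}=\frac{aP_{\max,\bar M+1}}{(1+a)\eta_{\max,\bar M+1}}+P_{\rm base,tx}-P_{\rm idle}.$$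
   Context: Setting: coherent joint transmission, in which the active transmission nodes with powers $P_m$ send the same symbol to one receiver with phase compensation; with active TNs $1,\dots,\bar M$ the data rate is $W\log_2\big[1+(\sum_{m=1}^{\bar M}\sqrt{P_m}|h_m|)^2/(I_{\rm out}+P_N)\big]$, which has to meet the required data rate $R_{\rm dl}>0$. Energy efficiency is $R_{\rm dl}$ divided by the total power consumption. Constants (all real): bandwidth $W>0$; noise power $P_N>0$; out-of-cluster interference power $I_{\rm out}\ge 0$; dynamic circuit power coefficient $\varepsilon\ge 0$; static circuit power $P_{\rm base,tx}\ge 0$; reception power $P_{\rm rx}\ge 0$ (constant, since the rate is fixed at $R_{\rm dl}$); idle power $P_{\rm idle}\ge 0$; parameter $a\ge 0$ of the envelope-tracking power amplifier (ETPA). $P_{\max,m}>0$ and $\eta_{\max,m}>0$ are the maximum output power and the maximum amplifier efficiency of TN $m$; they are assumed to be the same for all TNs, but the index $m$ is kept in the notation. Definition of $E_{\rm ETPA}^{\bar M}$: it is the value of $$\sum_{m=1}^{\bar M}\frac{P_m+aP_{\max,m}}{(1+a)\eta_{\max,m}}+\bar M P_{\rm base,tx}+(M-\bar M)P_{\rm idle}+\varepsilon R_{\rm dl}+P_{\rm rx}$$ at the optimal powers $$P_m=P_m^*=\frac{\big(2^{R_{\rm dl}/W}-1\big)\frac{\eta_{\max,m}^2|h_m|^2}{I_{\rm out}+P_N}}{\Big(\sum_{k=1}^{\bar M}\frac{\eta_{\max,k}|h_k|^2}{I_{\rm out}+P_N}\Big)^2},\qquad 1\le m\le\bar M,$$ that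 is, $$E_{\rm ETPA}^{\bar M}=\frac{2^{R_{\rm dl}/W}-1}{(1+a)\sum_{m=1}^{\bar M}\frac{\eta_{\max,m}|h_m|^2}{I_{\rm out}+P_N}}+\sum_{m=1}^{\bar M}\frac{aP_{\max,m}}{(1+a)\eta_{\max,m}}+\bar M P_{\rm base,tx}+(M-\bar M)P_{\rm idle}+\varepsilon R_{\rm dl}+P_{\rm rx}.$$ *)

theory Defs
  imports Complex_Main
begin

text \<open>
  Coherent joint transmission from transmission nodes (TNs) 1, ..., \<open>num_TNs\<close> to one receiver.
  Functions of a TN index are only meaningful on \<open>{1..num_TNs}\<close>.
\<close>

record jt_system =
  num_TNs :: nat
  channel :: "nat \<Rightarrow> complex"
  bandwidth :: real
  rate :: real \<comment> \<open>the required data rate \<open>R_dl\<close>\<close>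
  noise :: real \<comment> \<open>\<open>P_N\<close>\<close>
  interference :: real \<comment> \<open>out-of-cluster interference power \<open>I_out\<close>\<close>
  dyn_coeff :: real \<comment> \<open>dynamic circuit power per unit of data rate, \<open>\<epsilon>\<close>\<close>
  P_base :: real \<comment> \<open>static circuit power of an active TN, \<open>P_base,tx\<close>\<close>
  P_rx :: real
  P_idle :: real
  etpa :: real \<comment> \<open>envelope-tracking amplifier parameter \<open>a\<close>\<close>
  P_max :: "nat \<Rightarrow> real"
  eff_max :: "nat \<Rightarrow> real" \<comment> \<open>maximum amplifier efficiency \<open>\<eta>_max,m\<close>\<close>

definition \<Gamma> :: "jt_system \<Rightarrow> nat \<Rightarrow> real" where
  "\<Gamma> S m = eff_max S m * (cmod (channel S m))\<^sup>2 / (interference S + noise S)"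

definition total_power :: "jt_system \<Rightarrow> nat \<Rightarrow> (nat \<Rightarrow> real) \<Rightarrow> real" where
  "total_power S n P =
     (\<Sum>m=1..n. (P m + etpa S * P_max S m) / ((1 + etpa S) * eff_max S m))
     + real n * P_base S + (real (num_TNs S) - real n) * P_idle S
     + dyn_coeff S * rate S + P_rx S"

text \<open>
  The powers that minimise \<open>total_power S n\<close> subject to the rate constraint
  \<open>W log\<^sub>2 (1 + (\<Sum>m=1..n. \<surd>P\<^sub>m |h\<^sub>m|)\<^sup>2 / (I_out + P_N)) = R_dl\<close>; the caps \<open>P\<^sub>m \<le> P_max,m\<close> are
  not part of this closed form.
\<close>

definition optimal_power :: "jt_system \<Rightarrow> nat \<Rightarrow> nat \<Rightarrow> real" where
  "optimal_power S n m =
     (2 powr (rate S / bandwidth S) - 1)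
       * ((eff_max S m)\<^sup>2 * (cmod (channel S m))\<^sup>2 / (interference S + noise S))
     / (\<Sum>k=1..n. eff_max S k * (cmod (channel S k))\<^sup>2 / (interference S + noise S))\<^sup>2"

definition E_ETPA :: "jt_system \<Rightarrow> nat \<Rightarrow> real" where
  "E_ETPA S n = total_power S n (optimal_power S n)"

definition \<theta> :: "jt_system \<Rightarrow> nat \<Rightarrow> real" where
  "\<theta> S m = etpa S * P_max S m / ((1 + etpa S) * eff_max S m) + P_base S - P_idle S"

end

theory Submission imports Defs begin

text \<open>
  With \<open>c = 2 powr (R/W) - 1\<close>, the transmission part of the power at the optimum collapses to
  \<open>c / ((1 + a) G n)\<close>, where \<open>G n = \<Gamma> 1 + \<dots> + \<Gamma> n\<close>. Hence activating one more TN changes the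
  total power by \<open>\<theta> (n + 1) - c / (1 + a) * (1 / G n - 1 / G (n + 1))\<close>, and the difference of
  reciprocals is \<open>\<Gamma> (n + 1) / (G n * G (n + 1))\<close>.
\<close>

text \<open>One of the two efficiency factors in \<open>optimal_power\<close> goes into
  \<open>\<Gamma>\<close>. The other is kept separate so that it can cancel the amplifier efficiency
  in \<open>total_power\<close>.\<close>

lemma optimal_power_eq:
  "optimal_power S n m =
     (2 powr (rate S / bandwidth S) - 1) * eff_max S m * \<Gamma> S m / (\<Sum>k=1..n. \<Gamma> S k)\<^sup>2"
  by (simp add: optimal_power_def \<Gamma>_def power2_eq_square)

lemma E_ETPA_eq:
  assumes eff: "\<And>m. m \<in> {1..n} \<Longrightarrow> eff_max S m \<noteq> 0"
  shows "E_ETPA S n =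
    (2 powr (rate S / bandwidth S) - 1) / ((1 + etpa S) * (\<Sum>m=1..n. \<Gamma> S m))
    + (\<Sum>m=1..n. etpa S * P_max S m / ((1 + etpa S) * eff_max S m))
    + real n * P_base S + (real (num_TNs S) - real n) * P_idle S
    + dyn_coeff S * rate S + P_rx S"
proof -
  define c where "c = 2 powr (rate S / bandwidth S) - 1"
  define G where "G = (\<Sum>m=1..n. \<Gamma> S m)"
  have "(\<Sum>m=1..n. (optimal_power S n m + etpa S * P_max S m) / ((1 + etpa S) * eff_max S m)) =
      (\<Sum>m=1..n. c / ((1 + etpa S) * G\<^sup>2) * \<Gamma> S m
        + etpa S * P_max S m / ((1 + etpa S) * eff_max S m))"
    by (intro sum.cong) (use eff in \<open>auto simp: optimal_power_eq c_def G_def add_divide_distrib\<close>)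
  also have "\<dots> = c / ((1 + etpa S) * G\<^sup>2) * G
      + (\<Sum>m=1..n. etpa S * P_max S m / ((1 + etpa S) * eff_max S m))"
    by (simp add: sum.distrib G_def sum_distrib_left)
  \<comment> \<open>This covers \<open>G = 0\<close> as well: both sides are then 0, since division
    by zero yields 0.\<close>
  also have "c / ((1 + etpa S) * G\<^sup>2) * G = c / ((1 + etpa S) * G)"
    by (simp add: power2_eq_square)
  finally show ?thesis
    by (simp add: E_ETPA_def total_power_def c_def G_def)
qed

text \<open>An exact identity under nonvanishing conditions only; signs enter later, when it is
  turned into a comparison.\<close>

lemma E_ETPA_Suc_diff:
  assumes "\<And>m. m \<in> {1..n + 1} \<Longrightarrow> eff_max S m \<noteq> 0"
    and "(\<Sum>m=1..n. \<Gamma> S m) \<noteq> 0" and "(\<Sum>m=1..n+1. \<Gamma> S m) \<noteq> 0"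
  shows "E_ETPA S (n + 1) - E_ETPA S n = \<theta> S (n + 1)
    - (2 powr (rate S / bandwidth S) - 1) / (1 + etpa S)
      * (\<Gamma> S (n + 1) / ((\<Sum>m=1..n. \<Gamma> S m) * (\<Sum>m=1..n+1. \<Gamma> S m)))"
proof -
  define c where "c = 2 powr (rate S / bandwidth S) - 1"
  define G where "G k = (\<Sum>m=1..k. \<Gamma> S m)" for k
  have G: "G (n + 1) = G n + \<Gamma> S (n + 1)" "G n \<noteq> 0" "G (n + 1) \<noteq> 0"
    using assms by (simp_all add: G_def)
  \<comment> \<open>The rate-dependent circuit power and the reception power cancel. What is left
    besides the transmission terms is the amplifier offset of TN \<open>n + 1\<close>, one more
    \<open>P_base S\<close> and one less \<open>P_idle S\<close>, which together are
    \<open>\<theta> S (n + 1)\<close>.\<close>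
  have E_diff: "E_ETPA S (n + 1) - E_ETPA S n =
      c / ((1 + etpa S) * G (n + 1)) - c / ((1 + etpa S) * G n) + \<theta> S (n + 1)"
    using E_ETPA_eq[of n S] E_ETPA_eq[of "n + 1" S] assms(1)
    by (simp add: \<theta>_def c_def G_def left_diff_distrib distrib_right)
  have "\<Gamma> S (n + 1) / (G n * G (n + 1)) = 1 / G n - 1 / G (n + 1)"
    using G by (simp add: field_simps)
  then have "c / (1 + etpa S) * (\<Gamma> S (n + 1) / (G n * G (n + 1))) =
      c / ((1 + etpa S) * G n) - c / ((1 + etpa S) * G (n + 1))"
    by (simp add: right_diff_distrib)
  with E_diff show ?thesis
    by (simp add: c_def G_def)
qed

theorem theorem2:
  fixes S :: jt_system and n :: nat
  assumes "num_TNs S \<ge> 2"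
    and "\<And>m. m \<in> {1..num_TNs S} \<Longrightarrow> channel S m \<noteq> 0"
    and "\<And>m k. 1 \<le> m \<Longrightarrow> m \<le> k \<Longrightarrow> k \<le> num_TNs S \<Longrightarrow> cmod (channel S m) \<ge> cmod (channel S k)"
    and "bandwidth S > 0" and "rate S > 0" and "noise S > 0"
    and "interference S \<ge> 0" and "dyn_coeff S \<ge> 0"
    and "P_base S \<ge> 0" and "P_rx S \<ge> 0" and "P_idle S \<ge> 0" and "etpa S \<ge> 0"
    and "\<And>m. m \<in> {1..num_TNs S} \<Longrightarrow> P_max S m > 0"
    and "\<And>m. m \<in> {1..num_TNs S} \<Longrightarrow> eff_max S m > 0"
    and "\<And>m k. m \<in> {1..num_TNs S} \<Longrightarrow> k \<in> {1..num_TNs S} \<Longrightarrow> P_max S m = P_max S k"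
    and "\<And>m k. m \<in> {1..num_TNs S} \<Longrightarrow> k \<in> {1..num_TNs S} \<Longrightarrow> eff_max S m = eff_max S k"
    and "n \<in> {1..num_TNs S - 1}"
  shows "E_ETPA S (n + 1) < E_ETPA S n \<longleftrightarrow>
    \<Gamma> S (n + 1) / ((\<Sum>m=1..n. \<Gamma> S m) * (\<Sum>m=1..n+1. \<Gamma> S m))
      > \<theta> S (n + 1) * (1 + etpa S) / (2 powr (rate S / bandwidth S) - 1)"
proof -
  define c where "c = 2 powr (rate S / bandwidth S) - 1"
  define X where "X = \<Gamma> S (n + 1) / ((\<Sum>m=1..n. \<Gamma> S m) * (\<Sum>m=1..n+1. \<Gamma> S m))"
  have n: "1 \<le> n" "n + 1 \<le> num_TNs S"
    using assms(1,17) by auto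
  have \<Gamma>_pos: "\<Gamma> S m > 0" if "m \<in> {1..num_TNs S}" for m
    using assms(2)[OF that] assms(14)[OF that] assms(6,7) by (simp add: \<Gamma>_def)
  \<comment> \<open>The bound \<open>1 \<le> k\<close> makes the index set nonempty. Inside this
    proof \<open>sum_pos\<close> still denotes the general fact on finite sums.\<close>
  have sum_pos: "(\<Sum>m=1..k. \<Gamma> S m) > 0" if "1 \<le> k" "k \<le> num_TNs S" for k
    using that by (intro sum_pos) (auto intro!: \<Gamma>_pos)
  have c_pos: "c > 0"
    using assms(4,5) by (simp add: c_def)
  have eff: "eff_max S m \<noteq> 0" if "m \<in> {1..n + 1}" for m
    using assms(14)[of m] that n by fastforce
  have "E_ETPA S (n + 1) - E_ETPA S n = \<theta> S (n + 1) - c / (1 + etpa S) * X"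
    unfolding c_def X_def
    by (rule E_ETPA_Suc_diff) (use eff sum_pos[of n] sum_pos[of "n + 1"] n in auto)
  then have "E_ETPA S (n + 1) < E_ETPA S n \<longleftrightarrow> \<theta> S (n + 1) < c / (1 + etpa S) * X"
    by linarith
  \<comment> \<open>Both sides are multiplied by \<open>(1 + etpa S) / c\<close>, which is positive
    because \<open>c > 0\<close> and \<open>etpa S \<ge> 0\<close>; the sign of
    \<open>\<theta> S (n + 1)\<close> is arbitrary.\<close>
  also have "\<dots> \<longleftrightarrow> \<theta> S (n + 1) * (1 + etpa S) / c < X"
    using c_pos assms(12) by (simp add: field_simps)
  finally show ?thesis
    by (simp only: c_def X_def)
qed

end
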